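(* Consider a port-Hamiltonian system $\dot{\mathbf{x}}(t)=\mathbf{J}(\mathbf{x}(t))\nabla H(\mathbf{x}(t))+\mathbf{G}(\mathbf{x}(t))\mathbf{u}(t)$ on $\mathbb{R}^n$ with quadratic energy $H(\mathbf{x})=\frac12\mathbf{x}^T\mathbf{Q}\mathbf{x}$, $\mathbf{Q}=\mathbf{Q}^T>0$, and a numerical integration scheme of order $p$ for it. Let $\mathbf{x}^k_{s+1}$ be the numerical solution after one step of size $h$ starting at time $t^k_0$ from the exact value $\mathbf{x}^k_0=\mathbf{x}(t^k_0)$. Put $$\Delta\bar H^k=H(\mathbf{x}^k_{s+1})-H(\mathbf{x}^k_0),\qquad \Delta H^k=H(\mathbf{x}(t^k_0+h))-H(\mathbf{x}(t^k_0)).$$ Then the local energy error $\Delta\bar H^k-\Delta H^k$ is consistent with the numerical integration scheme, i.e. it has order $o(h^p)$, in the sense of the context: there is a constant $C>0$ such that $|\Delta\bar H^k-\Delta H^k|\le C h^{p+1}$ for all sufficiently small $h>0$.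
   Context: $\mathbf{J}(\mathbf{x})=-\mathbf{J}(\mathbf{x})^T\in\mathbb{R}^{n\times n}$, $\mathbf{G}(\mathbf{x})\in\mathbb{R}^{n\times m}$, $\mathbf{u}(t)\in\mathbb{R}^m$ is the input, and $\mathbf{x}(t)$ denotes the exact solution. The scheme is a one-step ($s$-stage Runge-Kutta/collocation type) method: $\mathbf{x}_i^k=\mathbf{x}_0^k-h\sum_{j=1}^s a_{ij}\mathbf{f}_j^k$ for $i=1,\dots,s$, and $\mathbf{x}_{s+1}^k=\mathbf{x}_0^k-h\sum_{j=1}^s b_j\mathbf{f}_j^k$, where $-\mathbf{f}_i^k=\mathbf{J}(\mathbf{x}_i^k)\nabla H(\mathbf{x}_i^k)+\mathbf{G}(\mathbf{x}_i^k)\mathbf{u}(t_0^k+c_ih)$. Convention on orders: a quantity is said to have "order $o(h^p)$" if its norm is bounded by $Ch^{p+1}$ for some constant $C>0$ and all sufficiently small $h>0$ (with the initial time $t_0^k$ and initial value fixed). The scheme has order $p$ if its local (consistency) error has order $o(h^p)$: when $\mathbf{x}_0^k=\mathbf{x}(t_0^k)$, there is $C_1>0$ with $\|\mathbf{x}_{s+1}^k-\mathbf{x}(t_0^k+h)\|\le C_1h^{p+1}$ for all sufficiently small $h>0$. *)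

theory Defs
  imports "HOL-Analysis.Analysis"
begin

definition grad :: "('a::real_inner \<Rightarrow> real) \<Rightarrow> 'a \<Rightarrow> 'a" where
  "grad f x = (THE D. GDERIV f x :> D)"

definition spd :: "real^'n^'n \<Rightarrow> bool" where
  "spd Q \<longleftrightarrow> transpose Q = Q \<and> (\<forall>v. v \<noteq> 0 \<longrightarrow> 0 < v \<bullet> (Q *v v))"

definition energy :: "real^'n^'n \<Rightarrow> real^'n \<Rightarrow> real" where
  "energy Q v = 1/2 * (v \<bullet> (Q *v v))"

definition ph_field ::
  "(real^'n \<Rightarrow> real^'n^'n) \<Rightarrow> (real^'n \<Rightarrow> real) \<Rightarrow> (real^'n \<Rightarrow> real^'m^'n) \<Rightarrow> real^'n \<Rightarrow> real^'m \<Rightarrow> real^'n"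
  where "ph_field J H G v w = J v *v grad H v + G v *v w"

definition ph_solution ::
  "(real^'n \<Rightarrow> real^'n^'n) \<Rightarrow> (real^'n \<Rightarrow> real) \<Rightarrow> (real^'n \<Rightarrow> real^'m^'n) \<Rightarrow> (real \<Rightarrow> real^'m)
    \<Rightarrow> real set \<Rightarrow> (real \<Rightarrow> real^'n) \<Rightarrow> bool"
  where "ph_solution J H G u I x \<longleftrightarrow>
    (\<forall>t\<in>I. (x has_vector_derivative ph_field J H G (x t) (u t)) (at t within I))"

text \<open>
  One step of size h of the s-stage Runge-Kutta scheme with coefficients a, b, c from time t0.
  The sequence X holds the initial value (index 0), the stages (indices 1 to s) and the result of
  the step (index s + 1). This is a relation because implicit stage equations may have no solution
  or several. The slopes f carry a minus sign, which the minus sign in the updates cancels.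
\<close>

definition rk_step ::
  "(real^'n \<Rightarrow> real^'n^'n) \<Rightarrow> (real^'n \<Rightarrow> real) \<Rightarrow> (real^'n \<Rightarrow> real^'m^'n) \<Rightarrow> (real \<Rightarrow> real^'m)
    \<Rightarrow> nat \<Rightarrow> (nat \<Rightarrow> nat \<Rightarrow> real) \<Rightarrow> (nat \<Rightarrow> real) \<Rightarrow> (nat \<Rightarrow> real)
    \<Rightarrow> real \<Rightarrow> real \<Rightarrow> (nat \<Rightarrow> real^'n) \<Rightarrow> bool"
  where "rk_step J H G u s a b c t0 h X \<longleftrightarrow>
    (\<exists>f. (\<forall>i\<in>{1..s}. - f i = ph_field J H G (X i) (u (t0 + c i * h))) \<and>
         (\<forall>i\<in>{1..s}. X i = X 0 - h *\<^sub>R (\<Sum>j=1..s. a i j *\<^sub>R f j)) \<and>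
         X (s + 1) = X 0 - h *\<^sub>R (\<Sum>j=1..s. b j *\<^sub>R f j))"

text \<open>
  "Order o(h^p)" in the consistency-order sense: a bound of size h^(p+1) as h tends to 0 from the
  right. This is not the Landau symbol o(h^p), which is a weaker condition.
\<close>

definition has_order :: "nat \<Rightarrow> (real \<Rightarrow> 'a::real_normed_vector) \<Rightarrow> bool" where
  "has_order p e \<longleftrightarrow> (\<exists>C>0. \<forall>\<^sub>F h in at_right 0. norm (e h) \<le> C * h ^ (p + 1))"

lemma grad_eqI:
  assumes "GDERIV f x :> D"
  shows "grad f x = D"
  unfolding grad_def
proof (rule the_equality)
  show "GDERIV f x :> D" by (fact assms)
next
  fix E assume "GDERIV f x :> E"
  then have "(\<lambda>h. h \<bullet> E) = (\<lambda>h. h \<bullet> D)"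
    using assms unfolding gderiv_def by (rule has_derivative_unique)
  then have "\<And>h. h \<bullet> (E - D) = 0"
    by (metis inner_diff_right right_minus_eq)
  then show "E = D"
    by (metis inner_eq_zero_iff right_minus_eq)
qed

lemma grad_energy:
  assumes "spd Q"
  shows "grad (energy Q) v = Q *v v"
proof (rule grad_eqI)
  have Q: "v \<bullet> (Q *v h) = h \<bullet> (Q *v v)" for h
    using assms dot_lmul_matrix[of v Q h] unfolding spd_def
    by (metis inner_commute transpose_matrix_vector)
  have "((*v) Q has_derivative (*v) Q) (at v)"
    by (rule bounded_linear_imp_has_derivative) (rule matrix_vector_mul_bounded_linear)
  from has_derivative_inner[OF has_derivative_ident this]
  have "((\<lambda>v. v \<bullet> (Q *v v)) has_derivative (\<lambda>h. v \<bullet> (Q *v h) + h \<bullet> (Q *v v))) (at v)" .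
  from has_derivative_mult_right[OF this, of "1/2"]
  show "GDERIV (energy Q) v :> Q *v v"
    unfolding gderiv_def energy_def[abs_def] Q by simp
qed

end

theory Submission
  imports Defs
begin

text \<open>
  A quadratic energy is Lipschitz on bounded sets, and for small steps the exact solution (by
  continuity at the initial time) and hence the numerical one stay in a fixed ball. The initial
  energies cancel, so the energy error is at most a constant times the consistency error.
\<close>

text \<open>Each of the two terms into which the energy difference splits carries a factor
  \<open>y - z\<close>, so Cauchy-Schwarz and an operator bound of \<open>Q\<close> suffice. The
  weight \<open>norm y + norm z\<close> turns this into a Lipschitz bound once both points are
  confined to a ball.\<close>

lemma energy_diff_bound:
  fixes Q :: "real^'n^'n"
  obtains K where "0 < K"
    and "\<And>y z. \<bar>energy Q y - energy Q z\<bar> \<le> K * norm (y - z) * (norm y + norm z)"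
proof -
  obtain K where K: "0 < K" "\<And>v. norm (Q *v v) \<le> norm v * K"
    using bounded_linear.pos_bounded[OF matrix_vector_mul_bounded_linear[of Q]] by blast
  have half: "\<bar>1/2 * (r + q)\<bar> \<le> \<bar>r\<bar> + \<bar>q\<bar>" for r q :: real
    using abs_triangle_ineq[of r q] by (simp add: abs_mult)
  have "\<bar>energy Q y - energy Q z\<bar> \<le> K * norm (y - z) * (norm y + norm z)" for y z
  proof -
    \<comment> \<open>The mixed term \<open>z \<bullet> (Q *v y)\<close> is subtracted and
      added.\<close>
    have "energy Q y - energy Q z = 1/2 * ((y - z) \<bullet> (Q *v y) + z \<bullet> (Q *v (y - z)))"
      unfolding energy_def
      by (simp add: inner_diff_left inner_diff_right matrix_vector_mult_diff_distrib)
    then have "\<bar>energy Q y - energy Q z\<bar> \<le> \<bar>(y - z) \<bullet> (Q *v y)\<bar> + \<bar>z \<bullet> (Q *v (y - z))\<bar>"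
      by (simp only: half)
    also have "\<dots> \<le> norm (y - z) * norm (Q *v y) + norm z * norm (Q *v (y - z))"
      by (intro add_mono Cauchy_Schwarz_ineq2)
    also have "\<dots> \<le> norm (y - z) * (norm y * K) + norm z * (norm (y - z) * K)"
      by (intro add_mono mult_left_mono K norm_ge_zero)
    also have "\<dots> = K * norm (y - z) * (norm y + norm z)"
      by (simp add: algebra_simps)
    finally show ?thesis .
  qed
  with K(1) show ?thesis by (rule that)
qed

text \<open>Differentiability within the interval gives continuity from the right at
  \<open>t0\<close>, so \<open>norm (x (t0 + h))\<close> tends to \<open>norm (x t0)\<close>; the
  added 1 is arbitrary slack.\<close>

lemma ph_solution_bounded_at_right:
  assumes "ph_solution J H G u {t0..t0 + T} x" and "0 < T"
  shows "\<forall>\<^sub>F h in at_right 0. norm (x (t0 + h)) < norm (x t0) + 1"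
proof -
  have "continuous_on {t0..t0 + T} x"
    using assms(1) unfolding ph_solution_def
    by (meson continuous_on_eq_continuous_within has_vector_derivative_continuous)
  then have "(x \<longlongrightarrow> x t0) (at_right t0)"
    using assms(2) by (auto intro: continuous_on_Icc_at_rightD)
  then have "((\<lambda>h. norm (x (t0 + h))) \<longlongrightarrow> norm (x t0)) (at_right 0)"
    by (subst (asm) filterlim_at_right_to_0) (auto simp: add.commute intro: tendsto_norm)
  then show ?thesis
    by (rule order_tendstoD) simp
qed

theorem theorem2:
  fixes J :: "real^'n \<Rightarrow> real^'n^'n"
    and G :: "real^'n \<Rightarrow> real^'m^'n"
    and Q :: "real^'n^'n"
    and u :: "real \<Rightarrow> real^'m"
    and x :: "real \<Rightarrow> real^'n"
    and s p :: nat
    and a :: "nat \<Rightarrow> nat \<Rightarrow> real"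
    and b c :: "nat \<Rightarrow> real"
    and t0 T :: real
    and X :: "real \<Rightarrow> nat \<Rightarrow> real^'n"
  assumes "\<And>v. J v = - transpose (J v)"
    and "spd Q"
    and "0 < T"
    and "ph_solution J (energy Q) G u {t0..t0 + T} x"
    and "\<forall>\<^sub>F h in at_right 0. X h 0 = x t0 \<and> rk_step J (energy Q) G u s a b c t0 h (X h)"
    and "has_order p (\<lambda>h. X h (s + 1) - x (t0 + h))"
  shows "has_order p (\<lambda>h. (energy Q (X h (s + 1)) - energy Q (X h 0))
                          - (energy Q (x (t0 + h)) - energy Q (x t0)))"
proof -
  obtain K where K: "0 < K"
    "\<And>y z. \<bar>energy Q y - energy Q z\<bar> \<le> K * norm (y - z) * (norm y + norm z)"
    using energy_diff_bound[of Q] by blast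
  obtain C where C: "0 < C"
    "\<forall>\<^sub>F h in at_right 0. norm (X h (s + 1) - x (t0 + h)) \<le> C * h ^ (p + 1)"
    using assms(6) unfolding has_order_def by blast
  define M where "M = norm (x t0) + 1"
  have "0 < M"
    unfolding M_def by (simp add: add_nonneg_pos)
  \<comment> \<open>\<open>h < 1\<close> gives \<open>h ^ (p + 1) \<le> 1\<close>, so the
    consistency error is at most \<open>C\<close>; \<open>0 < h\<close> keeps the bounds
    nonnegative.\<close>
  have unit: "\<forall>\<^sub>F h in at_right 0. 0 < h \<and> h < (1::real)"
    using eventually_at_right_real[of 0 1] by simp
  \<comment> \<open>The exact value has norm at most \<open>M\<close>, the numerical one at most
    \<open>M + C\<close>; hence the factor \<open>2 * M + C\<close>.\<close>
  have "\<forall>\<^sub>F h in at_right 0.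
      norm ((energy Q (X h (s + 1)) - energy Q (X h 0)) - (energy Q (x (t0 + h)) - energy Q (x t0)))
      \<le> K * C * (2 * M + C) * h ^ (p + 1)"
    using assms(5) C(2) ph_solution_bounded_at_right[OF assms(4,3)] unit
  proof eventually_elim
    case (elim h)
    let ?y = "X h (s + 1)" and ?z = "x (t0 + h)"
    have "C * h ^ (p + 1) \<le> C * 1"
      using elim(4) C(1) by (intro mult_left_mono power_le_one) auto
    then have "norm (?y - ?z) \<le> C"
      using elim(2) by linarith
    moreover have "norm ?z \<le> M"
      using elim(3) by (simp add: M_def)
    ultimately have sum: "norm ?y + norm ?z \<le> 2 * M + C"
      using norm_triangle_sub[of ?y ?z] by linarith
    have "\<bar>energy Q ?y - energy Q ?z\<bar> \<le> K * norm (?y - ?z) * (norm ?y + norm ?z)"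
      by (rule K(2))
    also have "\<dots> \<le> K * (C * h ^ (p + 1)) * (2 * M + C)"
      using elim(2,4) sum K(1) C(1) by (intro mult_mono) auto
    \<comment> \<open>Since \<open>X h 0 = x t0\<close>, the initial energies cancel and only the
      energies at the end of the step remain.\<close>
    finally show ?case
      using elim(1) by (simp add: mult_ac)
  qed
  moreover have "0 < K * C * (2 * M + C)"
    using K(1) C(1) \<open>0 < M\<close> by simp
  ultimately show ?thesis
    unfolding has_order_def by blast
qed

end
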